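(* Let $k\in\mathbb{N}_0$. For $m\in\mathbb{N}_0$, $$H_k(z,-m,1)=\frac{R_{m,k}(z,1)}{(1-z)^{m+3}},$$ where $$R_{m,k}(z,1)=\alpha_k\mathcal{A}_{m+2}(z)+(\beta_k-2\alpha_k)(1-z)\mathcal{A}_{m+1}(z)+(1-\beta_k+\alpha_k)(1-z)^2\mathcal{A}_m(z).$$ (The identity holds for $|z|<1$, and as an identity of rational functions for $z\neq1$.)
   Context: $\mathbb{N}_0=\{0,1,2,\ldots\}$. $\alpha_k=\frac32 4^k$, $\beta_k=\frac32 2^k$, and the $k$-augmented centered triangular numbers are given by $A(r+1,k)=\alpha_k r^2+\beta_k r+1$ for integers $r\ge0$. $H_k(z,s,a)=\sum_{r=0}^{\infty}\frac{A(r+1,k)z^r}{(r+a)^s}$, so for $|z|<1$, $H_k(z,-m,1)=\sum_{r=0}^\infty A(r+1,k)(r+1)^m z^r$; for other $z\neq1$, $H_k(z,-m,1)$ denotes the rational function of $z$ extending these values. $\mathcal{A}_n(z)$ is the Eulerian polynomial: $\mathcal{A}_0(z)=1$ and $\mathcal{A}_n(z)=\sum_{j=0}^{n-1}\left\langle {n\atop j}\right\rangle z^j$ for $n\ge1$, where $\left\langle {n\atop j}\right\rangle$ is the Eulerian number (the number of permutations of $\{1,\dots,n\}$ with exactly $j$ descents). *)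

theory Defs
  imports
    Complex_Main
    "HOL-Combinatorics.Permutations"
    "HOL-Computational_Algebra.Polynomial"
    "HOL-Analysis.Complex_Transcendental"
begin

definition alpha :: "nat \<Rightarrow> real" where
  "alpha k = 3 / 2 * 4 ^ k"

definition beta :: "nat \<Rightarrow> real" where
  "beta k = 3 / 2 * 2 ^ k"

(* The augmented centered triangular number A(n, k), used for n \<ge> 1 only;
   in the customary form n = r + 1. *)
definition aug_tri :: "nat \<Rightarrow> nat \<Rightarrow> real" where
  "aug_tri n k = alpha k * (real n - 1)\<^sup>2 + beta k * (real n - 1) + 1"

definition H_series :: "nat \<Rightarrow> complex \<Rightarrow> complex \<Rightarrow> complex \<Rightarrow> nat \<Rightarrow> complex" where
  "H_series k z s a r = of_real (aug_tri (r + 1) k) * z ^ r / (of_nat r + a) powr s"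

definition H :: "nat \<Rightarrow> complex \<Rightarrow> complex \<Rightarrow> complex \<Rightarrow> complex" where
  "H k z s a = (\<Sum>r. H_series k z s a r)"

(* The value at z of the rational function that agrees with H k u (-m) 1 on the
   open unit disc. A rational function is represented by a pair of polynomials
   P / Q; since Q does not vanish at z, it is not the zero polynomial, and any two
   such pairs define the same rational function. At the pole z = 1 the value is
   unspecified. *)
definition H_rat :: "nat \<Rightarrow> nat \<Rightarrow> complex \<Rightarrow> complex" where
  "H_rat k m z = (THE w. \<exists>P Q :: complex poly.
     (\<forall>u. norm u < 1 \<and> poly Q u \<noteq> 0 \<longrightarrow> H k u (- of_nat m) 1 = poly P u / poly Q u) \<and>
     poly Q z \<noteq> 0 \<and> w = poly P z / poly Q z)"

definition descents :: "nat \<Rightarrow> (nat \<Rightarrow> nat) \<Rightarrow> nat set" where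
  "descents n p = {i. 1 \<le> i \<and> i < n \<and> p i > p (i + 1)}"

definition eulerian :: "nat \<Rightarrow> nat \<Rightarrow> nat" where
  "eulerian n j = card {p. p permutes {1..n} \<and> card (descents n p) = j}"

definition eulerian_poly :: "nat \<Rightarrow> complex poly" where
  "eulerian_poly n =
     (if n = 0 then 1 else (\<Sum>j<n. monom (of_nat (eulerian n j)) j))"

definition R :: "nat \<Rightarrow> nat \<Rightarrow> complex \<Rightarrow> complex" where
  "R m k z =
     of_real (alpha k) * poly (eulerian_poly (m + 2)) z
     + of_real (beta k - 2 * alpha k) * (1 - z) * poly (eulerian_poly (m + 1)) z
     + of_real (1 - beta k + alpha k) * (1 - z)\<^sup>2 * poly (eulerian_poly m) z"

end

theory Submission
  imports Defs "HOL-Combinatorics.Multiset_Permutations"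
begin

text \<open>
  Writing \<open>r = (r + 1) - 1\<close> turns the weight \<open>A(r + 1, k)\<close> into the quadratic
  \<open>\<alpha> N\<^sup>2 + (\<beta> - 2\<alpha>) N + (1 - \<beta> + \<alpha>)\<close> in \<open>N = r + 1\<close>. Hence on the unit disc the
  series is a combination of the three series \<open>\<Sum>r. N\<^sup>n z\<^sup>r\<close> with
  \<open>n = m + 2, m + 1, m\<close>, and everything rests on the classical generating function
  \<open>\<Sum>r. (r + 1)\<^sup>n z\<^sup>r = A\<^sub>n(z) / (1 - z)\<^sup>n\<^sup>+\<^sup>1\<close> (\<open>eulerian_generating_function\<close>).

  That identity is an induction on \<open>n\<close>. The operator \<open>f \<mapsto> (z f)' = f + z f'\<close> multiplies
  the coefficient of \<open>z\<^sup>r\<close> by \<open>r + 1\<close>, and applied to the right-hand side it yields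
  the next right-hand side exactly when
  \<open>A\<^sub>n\<^sub>+\<^sub>1 = (1 + n z) A\<^sub>n + z (1 - z) A\<^sub>n'\<close>.

  The Eulerian polynomial is the generating polynomial of permutations by descents, so this
  recurrence (\<open>poly_eulerian_poly_Suc\<close>) is a statement about permutations: each
  permutation of \<open>{1..n + 1}\<close> arises exactly once by inserting \<open>n + 1\<close> into the one-line
  notation of a permutation of \<open>{1..n}\<close>. If the latter has \<open>d\<close> descents, then \<open>d + 1\<close> of
  the \<open>n + 1\<close> insertions keep the number of descents (inside a descent, or at the end), and
  the other \<open>n - d\<close> raise it by one (\<open>sum_list_descents_insert_max\<close>).

  Outside the disc, the value is that of any quotient of polynomials that agrees with the
  series on the disc; all of these coincide because a nonzero polynomial has only finitely
  many roots (\<open>rational_function_eqI\<close>).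
\<close>

section \<open>Permutations in one-line notation\<close>

text \<open>
  Insertion of a new maximum is awkward for permutations as functions, but for their
  one-line notations it is an operation on lists that is compatible with list recursion.
\<close>

fun list_descents :: "'a::linorder list \<Rightarrow> nat" where
  "list_descents (x # y # xs) = of_bool (y < x) + list_descents (y # xs)"
| "list_descents _ = 0"

lemma list_descents_conv_sum:
  "list_descents xs = (\<Sum>i<length xs - 1. of_bool (xs ! Suc i < xs ! i))"
  by (induction xs rule: list_descents.induct)
     (simp_all add: sum.lessThan_Suc_shift del: sum.lessThan_Suc)

lemma card_descents_one_line:
  "card (descents n p) = list_descents (map p [1..<Suc n])"
proof -
  have "descents n p = {i \<in> {1..<n}. p (Suc i) < p i}"
    by (auto simp: descents_def)
  hence "card (descents n p) = (\<Sum>i=1..<n. of_bool (p (Suc i) < p i))"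
    by (simp add: sum.inter_filter [symmetric] of_bool_def)
  also have "\<dots> = (\<Sum>i<n - 1. of_bool (p (Suc (Suc i)) < p (Suc i)))"
    by (rule sum.reindex_bij_witness[of _ Suc "\<lambda>i. i - 1"]) auto
  also have "\<dots> = list_descents (map p [1..<Suc n])"
    unfolding list_descents_conv_sum by (intro sum.cong) (auto simp: nth_append simp del: upt_Suc)
  finally show ?thesis .
qed

section \<open>Inserting a maximum\<close>

definition insert_at :: "'a \<Rightarrow> nat \<Rightarrow> 'a list \<Rightarrow> 'a list" where
  "insert_at M i xs = take i xs @ M # drop i xs"

lemma insert_at_simps [simp]:
  "insert_at M 0 xs = M # xs"
  "insert_at M (Suc i) (x # xs) = x # insert_at M i xs"
  by (simp_all add: insert_at_def)

text \<open>
  A maximum placed between \<open>a\<close> and \<open>b\<close> creates the descent \<open>M > b\<close> and destroys \<open>a > b\<close> if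
  there was one; placed at the end it creates none. The generating function over all positions
  states this without naming the positions, which makes it provable by induction on the list:
  only the first two positions interact with the new head.
\<close>

lemma sum_list_descents_insert_max:
  fixes z :: "'b::comm_ring_1"
  assumes "\<And>x. x \<in> set xs \<Longrightarrow> x < M"
  shows "(\<Sum>i\<le>length xs. z ^ list_descents (insert_at M i xs)) =
           (1 + of_nat (list_descents xs)) * z ^ list_descents xs
           + (of_nat (length xs) - of_nat (list_descents xs)) * z ^ Suc (list_descents xs)"
  using assms
proof (induction xs rule: list_descents.induct)
  case (1 x y xs)
  have less: "x < M" "y < M" "\<not> M < x" "\<not> M < y" using "1.prems" by (auto intro: order.asym)
  let ?S = "\<Sum>i\<le>length xs. z ^ list_descents (y # insert_at M i xs)"
  let ?d = "list_descents (y # xs)"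
  have tail: "(\<Sum>i\<le>length xs. z ^ list_descents (x # y # insert_at M i xs)) = z ^ of_bool (y < x) * ?S"
    by (simp add: sum_distrib_left power_add)
  \<comment> \<open>The induction hypothesis with the insertion before \<open>y\<close> split off: after prepending \<open>x\<close>,
    that insertion separates \<open>x\<close> from \<open>y\<close> and contributes differently from the others.\<close>
  have "z * z ^ ?d + ?S = (1 + of_nat ?d) * z ^ ?d
         + (of_nat (length (y # xs)) - of_nat ?d) * z ^ Suc ?d"
    using 1 less by (simp add: sum.atMost_Suc_shift del: sum.atMost_Suc)
  hence S: "?S = (1 + of_nat ?d) * z ^ ?d
         + (of_nat (length (y # xs)) - of_nat ?d) * z ^ Suc ?d - z * z ^ ?d"
    by (simp add: algebra_simps)
  have "(\<Sum>i\<le>length (x # y # xs). z ^ list_descents (insert_at M i (x # y # xs)))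
      = z ^ Suc (list_descents (x # y # xs)) + z ^ Suc ?d + z ^ of_bool (y < x) * ?S"
    unfolding tail[symmetric] using less
    by (simp add: sum.atMost_Suc_shift del: sum.atMost_Suc)
  also have "\<dots> = (1 + of_nat (list_descents (x # y # xs))) * z ^ list_descents (x # y # xs)
           + (of_nat (length (x # y # xs)) - of_nat (list_descents (x # y # xs))) 
             * z ^ Suc (list_descents (x # y # xs))"
    unfolding S by (cases "y < x") (simp_all add: algebra_simps)
  finally show ?case .
qed (auto simp: insert_at_def)

text \<open>
  Surjectivity here and for insertion below comes from counting: the map is injective and
  both sides have the same factorial as their cardinality.
\<close>

lemma bij_betw_one_line:
  "bij_betw (\<lambda>p. map p [1..<Suc n]) {p. p permutes {1..n}} (permutations_of_set {1..n})"
proof -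
  have inj: "inj_on (\<lambda>p. map p [1..<Suc n]) {p. p permutes {1..n}}"
  proof (rule inj_onI, rule ext)
    fix p q i
    assume "p \<in> {p. p permutes {1..n}}" "q \<in> {p. p permutes {1..n}}"
      and eq: "map p [1..<Suc n] = map q [1..<Suc n]"
    thus "p i = q i"
      by (cases "i \<in> {1..n}") (auto simp: permutes_not_in simp del: upt_Suc)
  qed
  have sub: "(\<lambda>p. map p [1..<Suc n]) ` {p. p permutes {1..n}} \<subseteq> permutations_of_set {1..n}"
    by (auto intro!: permutations_of_setI simp: permutes_image permutes_inj_on distinct_map
        atLeastLessThanSuc_atLeastAtMost simp del: upt_Suc)
  have "(\<lambda>p. map p [1..<Suc n]) ` {p. p permutes {1..n}} = permutations_of_set {1..n}"
    using inj sub by (intro card_subset_eq)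
      (simp_all add: card_image card_permutations[of _ n])
  with inj show ?thesis by (simp add: bij_betw_def)
qed

text \<open>
  The inserted element is new, so the list is recovered by filtering it out and the position by
  measuring the prefix before it.
\<close>

lemma bij_betw_insert_at:
  assumes "finite A" "M \<notin> A"
  shows "bij_betw (\<lambda>(xs, i). insert_at M i xs)
           (permutations_of_set A \<times> {..card A}) (permutations_of_set (insert M A))"
proof -
  let ?f = "\<lambda>(xs, i). insert_at M i xs"
  have inj: "inj_on ?f (permutations_of_set A \<times> {..card A})"
  proof (rule inj_on_inverseI)
    fix y assume "y \<in> permutations_of_set A \<times> {..card A}"
    then obtain xs i where y: "y = (xs, i)" "set xs = A" "distinct xs" "i \<le> card A"
      by (auto dest: permutations_of_setD)
    have notin: "M \<notin> set (take i xs)" "M \<notin> set (drop i xs)"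
      using y assms by (auto dest: in_set_takeD in_set_dropD)
    have len: "i \<le> length xs" using y distinct_card[of xs] by simp
    have "filter (\<lambda>x. x \<noteq> M) (take i xs) = take i xs" "filter (\<lambda>x. x \<noteq> M) (drop i xs) = drop i xs"
      using notin by (auto intro!: filter_True)
    hence "filter (\<lambda>x. x \<noteq> M) (insert_at M i xs) = xs"
      by (simp add: insert_at_def)
    moreover have "takeWhile (\<lambda>x. x \<noteq> M) (insert_at M i xs) = take i xs"
      using notin unfolding insert_at_def by (subst takeWhile_append2) auto
    ultimately show "(\<lambda>ys. (filter (\<lambda>x. x \<noteq> M) ys, length (takeWhile (\<lambda>x. x \<noteq> M) ys))) (?f y) = y"
      using y len by simp
  qed
  have sub: "?f ` (permutations_of_set A \<times> {..card A}) \<subseteq> permutations_of_set (insert M A)"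
  proof safe
    fix xs i assume "xs \<in> permutations_of_set A"
    hence xs: "set xs = A" "distinct xs" by (auto dest: permutations_of_setD)
    have "set (take i xs @ drop i xs) = A" "distinct (take i xs @ drop i xs)"
      using xs by simp_all
    hence "set (take i xs) \<union> set (drop i xs) = A" "distinct (take i xs)" "distinct (drop i xs)"
      "set (take i xs) \<inter> set (drop i xs) = {}"
      unfolding set_append distinct_append by auto
    thus "insert_at M i xs \<in> permutations_of_set (insert M A)"
      using assms(2) by (intro permutations_of_setI) (auto simp: insert_at_def)
  qed
  have "?f ` (permutations_of_set A \<times> {..card A}) = permutations_of_set (insert M A)"
    using inj sub assms by (intro card_subset_eq) (simp_all add: card_image card_cartesian_product)
  with inj show ?thesis by (simp add: bij_betw_def)
qed

section \<open>The recurrence of the Eulerian polynomials\<close>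

lemma eulerian_poly_conv_permutations:
  "eulerian_poly n = (\<Sum>p | p permutes {1..n}. monom 1 (card (descents n p)))"
proof (cases "n = 0")
  case True
  have "descents 0 id = {}" by (simp add: descents_def)
  with True show ?thesis by (simp add: eulerian_poly_def monom_0 flip: id_def)
next
  case False
  let ?P = "{p. p permutes {1..n}}"
  have fin: "finite ?P" by (rule finite_permutations) simp
  have less: "card (descents n p) < n" for p
  proof -
    have "card (descents n p) \<le> card {1..<n}"
      by (rule card_mono) (auto simp: descents_def)
    with False show ?thesis by simp
  qed
  have "eulerian_poly n = (\<Sum>j<n. \<Sum>p\<in>{p\<in>?P. card (descents n p) = j}. monom 1 (card (descents n p)))"
    using False
    by (simp add: eulerian_poly_def eulerian_def of_nat_monom mult_monom)
  also have "\<dots> = (\<Sum>p\<in>?P. monom 1 (card (descents n p)))"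
    using fin less by (intro sum.group) auto
  finally show ?thesis .
qed

lemma eulerian_poly_conv_lists:
  "eulerian_poly n = (\<Sum>xs\<in>permutations_of_set {1..n}. monom 1 (list_descents xs))"
  unfolding eulerian_poly_conv_permutations card_descents_one_line
  by (rule sum.reindex_bij_betw[OF bij_betw_one_line])

text \<open>
  A permutation of \<open>{1..n}\<close> with \<open>d\<close> descents contributes
  \<open>(d + 1) z\<^sup>d + (n - d) z\<^sup>d\<^sup>+\<^sup>1 = (1 + n z) z\<^sup>d + (1 - z) d z\<^sup>d\<close>, and the factor \<open>d\<close> is what
  \<open>z\<close> times the derivative produces.
\<close>

lemma poly_eulerian_poly_Suc:
  "poly (eulerian_poly (Suc n)) z = (1 + of_nat n * z) * poly (eulerian_poly n) z
     + z * (1 - z) * poly (pderiv (eulerian_poly n)) z"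
proof -
  let ?L = "permutations_of_set {1..n}"
  have ins: "insert (Suc n) {1..n} = {1..Suc n}" by auto
  have d: "z * poly (pderiv (eulerian_poly n)) z = (\<Sum>xs\<in>?L. of_nat (list_descents xs) * z ^ list_descents xs)"
  proof -
    have "z * (of_nat k * z ^ (k - 1)) = of_nat k * z ^ k" for k
      by (cases k) auto
    thus ?thesis
      unfolding eulerian_poly_conv_lists higher_pderiv_sum[of 1, simplified] pderiv_monom
        poly_sum poly_monom sum_distrib_left mult_1_right
      by (intro sum.cong refl)
  qed
  have "poly (eulerian_poly (Suc n)) z = (\<Sum>ys\<in>permutations_of_set (insert (Suc n) {1..n}). z ^ list_descents ys)"
    unfolding ins by (simp add: eulerian_poly_conv_lists poly_sum poly_monom)
  also have "\<dots> = (\<Sum>(xs, i)\<in>?L \<times> {..n}. z ^ list_descents (insert_at (Suc n) i xs))"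
    using sum.reindex_bij_betw[OF bij_betw_insert_at[of "{1..n}" "Suc n"], of "\<lambda>ys. z ^ list_descents ys"]
    by (simp add: case_prod_unfold)
  also have "\<dots> = (\<Sum>xs\<in>?L. \<Sum>i\<le>n. z ^ list_descents (insert_at (Suc n) i xs))"
    by (rule sum.cartesian_product [symmetric])
  also have "\<dots> = (\<Sum>xs\<in>?L. (1 + of_nat n * z) * z ^ list_descents xs
                + (1 - z) * (of_nat (list_descents xs) * z ^ list_descents xs))"
  proof (rule sum.cong)
    fix xs assume xs: "xs \<in> ?L"
    hence "length xs = n" using length_finite_permutations_of_set by force
    moreover have "x < Suc n" if "x \<in> set xs" for x
      using xs that by (auto dest: permutations_of_setD)
    ultimately show "(\<Sum>i\<le>n. z ^ list_descents (insert_at (Suc n) i xs)) =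
      (1 + of_nat n * z) * z ^ list_descents xs
                + (1 - z) * (of_nat (list_descents xs) * z ^ list_descents xs)"
      using sum_list_descents_insert_max[of xs "Suc n" z] by (simp add: algebra_simps)
  qed simp
  also have "\<dots> = (1 + of_nat n * z) * (\<Sum>xs\<in>?L. z ^ list_descents xs)
                 + (1 - z) * (z * poly (pderiv (eulerian_poly n)) z)"
    unfolding d by (simp add: sum.distrib sum_distrib_left)
  finally show ?thesis
    by (simp add: eulerian_poly_conv_lists poly_sum poly_monom mult_ac)
qed

section \<open>The generating function of the powers\<close>

text \<open>
  The induction step applies \<open>f \<mapsto> f + z f'\<close> to both sides: termwise to the power series, and
  by the quotient rule to the closed form, which equals it on the whole open disc. The recurrence
  of the Eulerian polynomials identifies the resulting numerator.
\<close>

theorem eulerian_generating_function: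
  fixes z :: complex
  assumes "norm z < 1"
  shows "(\<lambda>r. of_nat (r + 1) ^ n * z ^ r) sums (poly (eulerian_poly n) z / (1 - z) ^ Suc n)"
  using assms
proof (induction n arbitrary: z)
  case 0
  thus ?case using geometric_sums[of z] by (simp add: eulerian_poly_def)
next
  case (Suc n)
  let ?c = "\<lambda>r. of_nat (r + 1) ^ n :: complex"
  let ?E = "eulerian_poly n"
  have z1: "1 - z \<noteq> 0" using Suc.prems by auto
  have summ: "summable (\<lambda>r. ?c r * w ^ r)" if "norm w < 1" for w
    using Suc.IH[OF that] by (rule sums_summable)
  have "((\<lambda>w. \<Sum>r. ?c r * w ^ r) has_field_derivative (\<Sum>r. diffs ?c r * z ^ r)) (at z)"
    by (rule termdiffs_strong'[of 1]) (use summ Suc.prems in auto)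
  moreover have "((\<lambda>w. \<Sum>r. ?c r * w ^ r) has_field_derivative
      (poly (pderiv ?E) z / (1 - z) ^ Suc n + of_nat (Suc n) * poly ?E z / (1 - z) ^ Suc (Suc n))) (at z)"
  proof (rule has_field_derivative_transform_within_open)
    show "((\<lambda>w. poly ?E w / (1 - w) ^ Suc n) has_field_derivative
      (poly (pderiv ?E) z / (1 - z) ^ Suc n + of_nat (Suc n) * poly ?E z / (1 - z) ^ Suc (Suc n))) (at z)"
    proof (rule DERIV_cong[OF DERIV_divide[OF poly_DERIV DERIV_power]])
      show "((\<lambda>w. 1 - w) has_field_derivative -1) (at z)"
        by (auto intro!: derivative_eq_intros)
    qed (use z1 in \<open>simp_all add: divide_simps\<close>, simp add: algebra_simps)
    show "poly ?E w / (1 - w) ^ Suc n = (\<Sum>r. ?c r * w ^ r)" if "w \<in> ball 0 1" for w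
      using Suc.IH[of w] that by (simp add: sums_iff)
  qed (use Suc.prems in auto)
  ultimately have D: "(\<Sum>r. diffs ?c r * z ^ r) =
      poly (pderiv ?E) z / (1 - z) ^ Suc n + of_nat (Suc n) * poly ?E z / (1 - z) ^ Suc (Suc n)"
    by (rule DERIV_unique)
  have "summable (\<lambda>r. diffs ?c r * z ^ r)"
    by (rule termdiff_converges[of _ 1]) (use summ Suc.prems in auto)
  from summable_sums[OF this]
  have "(\<lambda>r. z * (diffs ?c r * z ^ r)) sums (z * (\<Sum>r. diffs ?c r * z ^ r))"
    by (rule sums_mult)
  hence "(\<lambda>r. of_nat (Suc r) * ?c (Suc r) * z ^ Suc r) sums (z * (\<Sum>r. diffs ?c r * z ^ r))"
    by (simp add: diffs_def mult_ac)
  \<comment> \<open>The shifted series may start at \<open>r = 0\<close> because the factor \<open>r\<close> vanishes there.\<close>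
  hence "(\<lambda>r. of_nat r * ?c r * z ^ r) sums (z * (\<Sum>r. diffs ?c r * z ^ r))"
    by (subst (asm) sums_Suc_iff) simp
  from sums_add[OF Suc.IH[OF Suc.prems] this]
  have "(\<lambda>r. of_nat (r + 1) ^ Suc n * z ^ r) sums
          (poly ?E z / (1 - z) ^ Suc n + z * (\<Sum>r. diffs ?c r * z ^ r))"
    by (simp add: algebra_simps)
  also have "poly ?E z / (1 - z) ^ Suc n + z * (\<Sum>r. diffs ?c r * z ^ r) =
       ((1 - z) * poly ?E z + z * (1 - z) * poly (pderiv ?E) z + z * of_nat (Suc n) * poly ?E z)
          / (1 - z) ^ Suc (Suc n)"
    unfolding D using z1 by (simp add: divide_simps) (simp add: algebra_simps)
  also have "(1 - z) * poly ?E z + z * (1 - z) * poly (pderiv ?E) z + z * of_nat (Suc n) * poly ?E z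
       = poly (eulerian_poly (Suc n)) z"
    unfolding poly_eulerian_poly_Suc by (simp add: algebra_simps)
  finally show ?case .
qed

section \<open>The series and its rational continuation\<close>

lemma H_series_eq:
  "H_series k z (- of_nat m) 1 r =
     of_real (alpha k) * (of_nat (r + 1) ^ (m + 2) * z ^ r)
     + of_real (beta k - 2 * alpha k) * (of_nat (r + 1) ^ (m + 1) * z ^ r)
     + of_real (1 - beta k + alpha k) * (of_nat (r + 1) ^ m * z ^ r)"
proof -
  have "(of_nat r + 1 :: complex) \<noteq> 0"
    by (metis of_nat_Suc of_nat_eq_0_iff add.commute nat.distinct(1))
  hence powr: "(of_nat r + 1 :: complex) powr (- of_nat m) = inverse (of_nat (r + 1) ^ m)"
    by (simp add: powr_minus powr_nat add.commute)
  have expand: "(a * N\<^sup>2 + b * N + c) * w / inverse (N ^ m)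
          = a * (N ^ (m + 2) * w) + b * (N ^ (m + 1) * w) + c * (N ^ m * w)" for a b c N w :: complex
    by (simp add: divide_inverse power_add power2_eq_square ring_distribs mult_ac)
  have aug: "(of_real (aug_tri (r + 1) k) :: complex) =
          of_real (alpha k) * (of_nat (r + 1))\<^sup>2
          + of_real (beta k - 2 * alpha k) * of_nat (r + 1)
          + of_real (1 - beta k + alpha k)"
    by (simp add: aug_tri_def algebra_simps power2_eq_square)
  show ?thesis
    unfolding H_series_def powr aug by (rule expand)
qed

lemma H_series_sums:
  assumes "norm z < 1"
  shows "H_series k z (- of_nat m) 1 sums (R m k z / (1 - z) ^ (m + 3))"
proof -
  have z1: "1 - z \<noteq> 0" using assms by auto
  note E = eulerian_generating_function[OF assms]
  have "H_series k z (- of_nat m) 1 sums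
    (of_real (alpha k) * (poly (eulerian_poly (m + 2)) z / (1 - z) ^ Suc (m + 2))
     + of_real (beta k - 2 * alpha k) * (poly (eulerian_poly (m + 1)) z / (1 - z) ^ Suc (m + 1))
     + of_real (1 - beta k + alpha k) * (poly (eulerian_poly m) z / (1 - z) ^ Suc m))"
    unfolding H_series_eq[abs_def] by (intro sums_add sums_mult E)
  also have "\<dots> = R m k z / (1 - z) ^ (m + 3)"
    using z1 unfolding R_def
    by (simp add: add_divide_distrib power_add power2_eq_square power3_eq_cube mult_ac)
  finally show ?thesis .
qed

text \<open>
  Cross-multiplication turns agreement on an infinite set, apart from the finitely many zeros of
  the denominators, into an identity of polynomials.
\<close>

lemma rational_function_eqI:
  fixes P Q P' Q' :: "'a::field poly"
  assumes "infinite S"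
    and eq: "\<And>u. u \<in> S \<Longrightarrow> poly Q u \<noteq> 0 \<Longrightarrow> poly Q' u \<noteq> 0 \<Longrightarrow> poly P u / poly Q u = poly P' u / poly Q' u"
    and "poly Q z \<noteq> 0" "poly Q' z \<noteq> 0"
  shows "poly P z / poly Q z = poly P' z / poly Q' z"
proof -
  have "Q * Q' \<noteq> 0" using assms(3,4) by auto
  let ?T = "S - {u. poly (Q * Q') u = 0}"
  have "infinite ?T"
    using assms(1) poly_roots_finite[OF \<open>Q * Q' \<noteq> 0\<close>] by (rule Diff_infinite_finite[rotated])
  moreover have "?T \<subseteq> {u. poly (P * Q' - P' * Q) u = 0}"
    using eq by (auto simp: field_simps)
  ultimately have "P * Q' - P' * Q = 0"
    using poly_roots_finite finite_subset by blast
  hence "poly (P * Q') z = poly (P' * Q) z" by simp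
  thus ?thesis using assms(3,4) by (simp add: field_simps)
qed

theorem corollary7p9:
  fixes k m :: nat
  shows "(\<forall>z :: complex. norm z < 1 \<longrightarrow>
            summable (H_series k z (- of_nat m) 1) \<and>
            H k z (- of_nat m) 1 = R m k z / (1 - z) ^ (m + 3)) \<and>
         (\<forall>z :: complex. z \<noteq> 1 \<longrightarrow>
            H_rat k m z = R m k z / (1 - z) ^ (m + 3))"
proof -
  have H: "H k z (- of_nat m) 1 = R m k z / (1 - z) ^ (m + 3)" if "norm z < 1" for z
    using H_series_sums[OF that] by (simp add: H_def sums_iff)
  have "H_rat k m z = R m k z / (1 - z) ^ (m + 3)" if "z \<noteq> 1" for z
  proof -
    define P0 where "P0 = [:of_real (alpha k):] * eulerian_poly (m + 2)
      + [:of_real (beta k - 2 * alpha k):] * [:1, -1:] * eulerian_poly (m + 1)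
      + [:of_real (1 - beta k + alpha k):] * [:1, -1:]\<^sup>2 * eulerian_poly m"
    define Q0 :: "complex poly" where "Q0 = [:1, -1:] ^ (m + 3)"
    have P0: "poly P0 u = R m k u" for u
      by (simp add: P0_def R_def algebra_simps)
    have Q0: "poly Q0 u = (1 - u) ^ (m + 3)" for u
      by (simp add: Q0_def)
    have Q0z: "poly Q0 z \<noteq> 0" using that by (simp add: Q0)
    have "infinite (ball 0 1 :: complex set)"
      using uncountable_ball[of 1 "0::complex"] countable_finite by auto
    note unique = rational_function_eqI[OF this _ _ Q0z]
    show ?thesis
      unfolding H_rat_def
    proof (rule the_equality, goal_cases)
      case 1
      show ?case
        using Q0z H by (intro exI[of _ P0] exI[of _ Q0]) (simp add: P0 Q0)
    next
      case (2 w)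
      then obtain P Q where PQ: "\<And>u. norm u < 1 \<Longrightarrow> poly Q u \<noteq> 0 \<Longrightarrow>
            H k u (- of_nat m) 1 = poly P u / poly Q u"
        "poly Q z \<noteq> 0" "w = poly P z / poly Q z" by blast
      have "poly P z / poly Q z = poly P0 z / poly Q0 z"
        by (rule unique) (use PQ(1,2) H in \<open>auto simp: P0 Q0\<close>)
      with PQ(3) show ?case by (simp add: P0 Q0)
    qed
  qed
  with H show ?thesis by (auto intro: sums_summable[OF H_series_sums])
qed

end
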